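(* Let $k$ be a field of characteristic zero and let $$F=x^2u^3+xyu^2v+y^2uv^2+z^2v^3\in k[u,v,x,y,z],$$ with corresponding algebra $A=Q/\mathrm{Ann}_Q F$, where $Q=k[U,V,X,Y,Z]$ with $U=\partial/\partial u$, $V=\partial/\partial v$, $X=\partial/\partial x$, $Y=\partial/\partial y$, $Z=\partial/\partial z$. Then: (a) $U,V,X,Y,Z$ are linearly independent in $A$, and the Hessian of $F$ with respect to this basis of $A_1$ is $$\mathrm{Hess}\,F=48u^3v^3\big(u^5x^4+8u^4vx^3y+16u^3v^2x^2y^2+19u^2v^3x^2z^2+9u^2v^3xy^3+13uv^4xyz^2+2uv^4y^4+4v^5y^2z^2\big)\neq 0.$$ (b) The monomials $$U^2,\;V^2,\;UV,\;X^2,\;Y^2,\;Z^2,\;XY,\;UX,\;UY,\;VX,\;VY,\;VZ$$ form a linear basis of $A_2$, and the second Hessian of $F$ with respect to it is identically zero: $\mathrm{Hess}^{(2)}F=0$. (c) The algebra $A$ has Hilbert function $(1,5,12,12,5,1)$, and $A$ does not have the weak Lefschetz property. In particular, there exists a polynomial $F$ of degree $5$ in $5$ variables with $\mathrm{Hess}\,F\neq0$ and $\mathrm{Hess}^{(2)}F=0$.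
   Context: $Q$ acts on the polynomial ring $k[u,v,x,y,z]$ by differential operators as indicated, and $\mathrm{Ann}_Q F=\{a\in Q\mid aF=0\}$, a homogeneous ideal when $F$ is homogeneous; $A=Q/\mathrm{Ann}_Q F=\bigoplus_{d=0}^D A_d$ is a graded Artinian Gorenstein algebra with $D=\deg F$ (here $D=5$). $A$ has the weak Lefschetz property if there is $L\in A_1$ such that the multiplication map $\times L:A_i\to A_{i+1}$ is injective or surjective for every $i=0,\ldots,D-1$. Given a $k$-linear basis $\mathbf{B}_d=\{\alpha_i\}_i$ of $A_d$ (represented by homogeneous polynomials of degree $d$ in $Q$), the $d$-th Hessian of $F$ is $\mathrm{Hess}^{(d)}F=\det\big((\alpha_i\alpha_jF)_{i,j=1}^{\dim_k A_d}\big)$, a polynomial in the variables of $F$; changing the basis multiplies it by a nonzero scalar. $\mathrm{Hess}\,F$ denotes $\mathrm{Hess}^{(1)}F$, which for the basis of first-order partial derivatives is the usual Hessian determinant. *)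

theory Defs
  imports
    "HOL-Library.Poly_Mapping"
    "HOL-Algebra.QuotRing"
    "HOL-Algebra.Embedded_Algebras"
    "Jordan_Normal_Form.Determinant"
begin

text \<open>
  Polynomials in indeterminates \<open>'v\<close> over \<open>'k\<close>: finitely supported functions on exponent
  vectors, multiplied by convolution. The ring of differential operators with constant
  coefficients has the same type; there the indeterminate \<open>i\<close> stands for the partial derivative
  with respect to the variable \<open>i\<close>.
\<close>

type_synonym ('v, 'k) mpoly = "('v \<Rightarrow>\<^sub>0 nat) \<Rightarrow>\<^sub>0 'k"

definition mvar :: "'v \<Rightarrow> ('v, 'k::comm_ring_1) mpoly" where
  "mvar i = Poly_Mapping.single (Poly_Mapping.single i 1) 1"

definition mconst :: "'k::comm_ring_1 \<Rightarrow> ('v, 'k) mpoly" where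
  "mconst c = Poly_Mapping.single 0 c"

definition mdeg :: "('v \<Rightarrow>\<^sub>0 nat) \<Rightarrow> nat" where
  "mdeg m = (\<Sum>i\<in>Poly_Mapping.keys m. Poly_Mapping.lookup m i)"

text \<open>The zero polynomial is homogeneous of every degree.\<close>

definition homogeneous :: "nat \<Rightarrow> ('v, 'k::comm_ring_1) mpoly \<Rightarrow> bool" where
  "homogeneous d p \<longleftrightarrow> (\<forall>m\<in>Poly_Mapping.keys p. mdeg m = d)"

definition total_degree :: "('v, 'k::comm_ring_1) mpoly \<Rightarrow> nat" where
  "total_degree p = Max (insert 0 (mdeg ` Poly_Mapping.keys p))"

text \<open>Exponent subtraction is truncated, but the terms where this matters have coefficient 0.\<close>

definition pdiff :: "'v \<Rightarrow> ('v, 'k::comm_ring_1) mpoly \<Rightarrow> ('v, 'k) mpoly" where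
  "pdiff i F = (\<Sum>m\<in>Poly_Mapping.keys F.
     Poly_Mapping.single (m - Poly_Mapping.single i 1)
       (of_nat (Poly_Mapping.lookup m i) * Poly_Mapping.lookup F m))"

definition pdiff_monom :: "('v \<Rightarrow>\<^sub>0 nat) \<Rightarrow> ('v, 'k::comm_ring_1) mpoly \<Rightarrow> ('v, 'k) mpoly" where
  "pdiff_monom m F =
     Finite_Set.fold (\<lambda>i. pdiff i ^^ Poly_Mapping.lookup m i) F (Poly_Mapping.keys m)"

definition diff_act :: "('v, 'k::comm_ring_1) mpoly \<Rightarrow> ('v, 'k) mpoly \<Rightarrow> ('v, 'k) mpoly" where
  "diff_act a F =
     (\<Sum>m\<in>Poly_Mapping.keys a. mconst (Poly_Mapping.lookup a m) * pdiff_monom m F)"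

lemma lookup_pdiff:
  fixes F :: "('v, 'k::comm_ring_1) mpoly"
  shows "Poly_Mapping.lookup (pdiff i F) n =
     of_nat (Suc (Poly_Mapping.lookup n i)) * Poly_Mapping.lookup F (n + Poly_Mapping.single i 1)"
proof -
  have *: "(m - Poly_Mapping.single i 1 = n \<and> Poly_Mapping.lookup m i \<noteq> 0) \<longleftrightarrow>
      m = n + Poly_Mapping.single i 1" for m :: "'v \<Rightarrow>\<^sub>0 nat"
  proof
    assume A: "m - Poly_Mapping.single i 1 = n \<and> Poly_Mapping.lookup m i \<noteq> 0"
    show "m = n + Poly_Mapping.single i 1"
      by (rule poly_mapping_eqI)
        (use A in \<open>auto simp: lookup_add lookup_minus lookup_single when_def\<close>)
  qed (auto simp: lookup_add)
  have "Poly_Mapping.lookup (pdiff i F) n =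
     (\<Sum>m\<in>Poly_Mapping.keys F. if m = n + Poly_Mapping.single i 1
        then of_nat (Poly_Mapping.lookup m i) * Poly_Mapping.lookup F m else 0)"
    unfolding pdiff_def lookup_sum
  proof (rule sum.cong[OF refl])
    fix m
    show "Poly_Mapping.lookup (Poly_Mapping.single (m - Poly_Mapping.single i 1)
         (of_nat (Poly_Mapping.lookup m i) * Poly_Mapping.lookup F m)) n =
      (if m = n + Poly_Mapping.single i 1
        then of_nat (Poly_Mapping.lookup m i) * Poly_Mapping.lookup F m else 0)"
      using *[of m]
      by (cases "Poly_Mapping.lookup m i = 0") (simp_all add: lookup_single when_def)
  qed
  also have "\<dots> = of_nat (Suc (Poly_Mapping.lookup n i)) *
      Poly_Mapping.lookup F (n + Poly_Mapping.single i 1)"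
    by (simp add: lookup_add in_keys_iff)
  finally show ?thesis .
qed

lemma pdiff_commute: "pdiff i (pdiff j F) = pdiff j (pdiff i F)"
  by (rule poly_mapping_eqI)
    (cases "i = j"; simp add: lookup_pdiff lookup_add lookup_single when_def ac_simps)

lemma pdiff_pow_commute_apply:
  "(pdiff i ^^ a) ((pdiff j ^^ b) F) = (pdiff j ^^ b) ((pdiff i ^^ a) F)"
proof -
  have "pdiff i ((pdiff j ^^ b) G) = (pdiff j ^^ b) (pdiff i G)" for G :: "('a, 'b) mpoly"
    by (induction b) (simp_all add: pdiff_commute[of i j])
  then show ?thesis
    by (induction a) simp_all
qed

lemma pdiff_pow_commute: "(pdiff i ^^ a) \<circ> (pdiff j ^^ b) = (pdiff j ^^ b) \<circ> (pdiff i ^^ a)"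
  by (rule ext) (simp add: pdiff_pow_commute_apply[of a i b j])

text \<open>The fold in \<open>pdiff_monom\<close> is well defined.\<close>

lemma comp_fun_commute_pdiff: "comp_fun_commute (\<lambda>i. pdiff i ^^ f i)"
  by (rule comp_fun_commute.intro) (rule pdiff_pow_commute)

lemma pdiff_monom_superset:
  assumes "finite A" "Poly_Mapping.keys m \<subseteq> A"
  shows "pdiff_monom m F = Finite_Set.fold (\<lambda>i. pdiff i ^^ Poly_Mapping.lookup m i) F A"
proof -
  interpret comp_fun_commute "\<lambda>i. pdiff i ^^ Poly_Mapping.lookup m i"
    by (rule comp_fun_commute_pdiff)
  have "Finite_Set.fold (\<lambda>i. pdiff i ^^ Poly_Mapping.lookup m i) F (B \<union> Poly_Mapping.keys m) =
      pdiff_monom m F" if "finite B" "B \<inter> Poly_Mapping.keys m = {}" for B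
    using that
    by (induction B) (auto simp: pdiff_monom_def in_keys_iff)
  from this[of "A - Poly_Mapping.keys m"] assms show ?thesis
    by (simp add: Un_absorb2 Diff_disjoint Int_commute)
qed

lemma pdiff_monom_zero [simp]: "pdiff_monom 0 F = F"
  by (simp add: pdiff_monom_def)

lemma pdiff_monom_add: "pdiff_monom (m + n) F = pdiff_monom m (pdiff_monom n F)"
proof -
  define A where "A = Poly_Mapping.keys m \<union> Poly_Mapping.keys n"
  have fA: "finite A" by (simp add: A_def)
  have sub: "Poly_Mapping.keys (m + n) \<subseteq> A" unfolding A_def by (rule keys_add)
  have cm: "(pdiff i ^^ a) (Finite_Set.fold (\<lambda>i. pdiff i ^^ f i) G B) =
      Finite_Set.fold (\<lambda>i. pdiff i ^^ f i) ((pdiff i ^^ a) G) B"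
    if "finite B" for B i a f and G :: "('a, 'b) mpoly"
    using that
  proof (induction B)
    case (insert x B)
    interpret comp_fun_commute "\<lambda>i. pdiff i ^^ f i"
      by (rule comp_fun_commute_pdiff)
    have "(pdiff i ^^ a) ((pdiff x ^^ f x) (Finite_Set.fold (\<lambda>i. pdiff i ^^ f i) G B)) =
        (pdiff x ^^ f x) (Finite_Set.fold (\<lambda>i. pdiff i ^^ f i) ((pdiff i ^^ a) G) B)"
      by (simp only: pdiff_pow_commute_apply[of a i "f x" x] insert.IH)
    with insert.hyps show ?case by simp
  qed simp
  have "Finite_Set.fold (\<lambda>i. pdiff i ^^ (f i + g i)) F B =
      Finite_Set.fold (\<lambda>i. pdiff i ^^ f i) (Finite_Set.fold (\<lambda>i. pdiff i ^^ g i) F B) B"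
    if "finite B" for f g and B :: "'a set"
    using that
  proof (induction B)
    case (insert x B)
    interpret f: comp_fun_commute "\<lambda>i. pdiff i ^^ f i" by (rule comp_fun_commute_pdiff)
    interpret g: comp_fun_commute "\<lambda>i. pdiff i ^^ g i" by (rule comp_fun_commute_pdiff)
    interpret fg: comp_fun_commute "\<lambda>i. pdiff i ^^ (f i + g i)" by (rule comp_fun_commute_pdiff)
    show ?case using insert
      by (simp only: fg.fold_insert[OF insert.hyps] f.fold_insert[OF insert.hyps]
          g.fold_insert[OF insert.hyps] cm[OF insert.hyps(1), symmetric])
        (simp add: funpow_add)
  qed simp
  from this[OF fA] show ?thesis
    using fA sub by (simp add: pdiff_monom_superset[of A] A_def lookup_add)
qed

lemma pdiff_add: "pdiff i (F + G) = pdiff i F + pdiff i G"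
  by (rule poly_mapping_eqI) (simp add: lookup_pdiff lookup_add algebra_simps)

lemma lookup_mconst_mult [simp]:
  "Poly_Mapping.lookup (mconst c * F) m = c * Poly_Mapping.lookup F m"
proof -
  have "mconst c * F = Poly_Mapping.map ((*) c) F"
    unfolding mconst_def by (simp add: mult_map_scale_conv_mult)
  then show ?thesis by (simp add: Poly_Mapping.map.rep_eq when_def)
qed

lemma pdiff_scale: "pdiff i (mconst c * F) = mconst c * pdiff i F"
  by (rule poly_mapping_eqI) (simp add: lookup_pdiff mult.left_commute)

lemma pdiff_monom_single: "pdiff_monom (Poly_Mapping.single i n) F = (pdiff i ^^ n) F"
proof -
  interpret comp_fun_commute "\<lambda>j. pdiff j ^^ Poly_Mapping.lookup (Poly_Mapping.single i n) j"
    by (rule comp_fun_commute_pdiff)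
  show ?thesis by (simp add: pdiff_monom_superset[of "{i}"])
qed

lemma pdiff_monom_linear:
  "pdiff_monom m (F + G) = pdiff_monom m F + pdiff_monom m G"
  "pdiff_monom m (mconst c * F) = mconst c * pdiff_monom m F"
proof -
  have p: "(pdiff i ^^ n) (F + G) = (pdiff i ^^ n) F + (pdiff i ^^ n) G"
    "(pdiff i ^^ n) (mconst c * F) = mconst c * (pdiff i ^^ n) F"
    for i n and F G :: "('a, 'b) mpoly"
    by (induction n) (simp_all add: pdiff_add pdiff_scale)
  interpret comp_fun_commute "\<lambda>i. pdiff i ^^ Poly_Mapping.lookup m i"
    by (rule comp_fun_commute_pdiff)
  have "Finite_Set.fold (\<lambda>i. pdiff i ^^ Poly_Mapping.lookup m i) (F + G) B =
      Finite_Set.fold (\<lambda>i. pdiff i ^^ Poly_Mapping.lookup m i) F B +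
      Finite_Set.fold (\<lambda>i. pdiff i ^^ Poly_Mapping.lookup m i) G B"
    "Finite_Set.fold (\<lambda>i. pdiff i ^^ Poly_Mapping.lookup m i) (mconst c * F) B =
      mconst c * Finite_Set.fold (\<lambda>i. pdiff i ^^ Poly_Mapping.lookup m i) F B"
    if "finite B" for B
    using that by (induction B) (simp_all add: p)
  then show "pdiff_monom m (F + G) = pdiff_monom m F + pdiff_monom m G"
    "pdiff_monom m (mconst c * F) = mconst c * pdiff_monom m F"
    by (simp_all add: pdiff_monom_def)
qed

lemma mconst_0 [simp]: "mconst 0 = 0"
  by (simp add: mconst_def)

lemma mconst_add: "mconst (c + d) = mconst c + mconst d"
  by (simp add: mconst_def single_add)

lemma mconst_mult: "mconst (c * d) = mconst c * mconst d"
  by (simp add: mconst_def mult_single)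

lemma diff_act_superset:
  assumes "finite M" "Poly_Mapping.keys a \<subseteq> M"
  shows "diff_act a F = (\<Sum>m\<in>M. mconst (Poly_Mapping.lookup a m) * pdiff_monom m F)"
  unfolding diff_act_def
  by (rule sum.mono_neutral_left) (use assms in \<open>auto simp: in_keys_iff\<close>)

lemma diff_act_0_left [simp]: "diff_act 0 F = 0"
  by (simp add: diff_act_def)

lemma diff_act_add_left: "diff_act (a + b) F = diff_act a F + diff_act b F"
proof -
  let ?M = "Poly_Mapping.keys a \<union> Poly_Mapping.keys b"
  have "Poly_Mapping.keys (a + b) \<subseteq> ?M" by (rule keys_add)
  then show ?thesis
    by (simp add: diff_act_superset[of ?M] lookup_add mconst_add algebra_simps sum.distrib)
qed

lemma diff_act_add_right: "diff_act a (F + G) = diff_act a F + diff_act a G"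
  by (simp add: diff_act_def pdiff_monom_linear algebra_simps sum.distrib)

lemma diff_act_0_right [simp]: "diff_act a 0 = 0"
  using diff_act_add_right[of a 0 0] by simp

lemma diff_act_single: "diff_act (Poly_Mapping.single m c) F = mconst c * pdiff_monom m F"
  by (cases "c = 0") (simp_all add: diff_act_def)

lemma diff_act_scale: "diff_act a (mconst c * F) = mconst c * diff_act a F"
  by (simp add: diff_act_def pdiff_monom_linear sum_distrib_left mult.left_commute)

lemma mpoly_induct [case_names single add]:
  fixes a :: "('v, 'k::comm_ring_1) mpoly"
  assumes "\<And>m c. P (Poly_Mapping.single m c)" "\<And>a b. P a \<Longrightarrow> P b \<Longrightarrow> P (a + b)"
  shows "P a"
proof -
  have a: "a = (\<Sum>m\<in>Poly_Mapping.keys a. Poly_Mapping.single m (Poly_Mapping.lookup a m))"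
    by (rule poly_mapping_eqI)
      (simp add: lookup_sum lookup_single when_def in_keys_iff)
  have "P (\<Sum>m\<in>M. Poly_Mapping.single m (Poly_Mapping.lookup a m))" if "finite M" for M
    using that
  proof (induction M)
    case empty
    show ?case using assms(1)[of 0 0] by simp
  qed (simp add: assms)
  then show ?thesis by (subst a) simp
qed

text \<open>The operators form an algebra acting on polynomials: products act by composition.\<close>

lemma diff_act_mult: "diff_act (a * b) F = diff_act a (diff_act b F)"
proof (induction a rule: mpoly_induct)
  case (single m c)
  show ?case
  proof (induction b rule: mpoly_induct)
    case (single n d)
    show ?case
      by (simp add: mult_single diff_act_single pdiff_monom_add pdiff_monom_linear mconst_mult
          ac_simps)
  next
    case (add b b')
    then show ?case by (simp add: distrib_left diff_act_add_left diff_act_add_right)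
  qed
next
  case (add a a')
  then show ?case by (simp add: distrib_right diff_act_add_left)
qed

lemma diff_act_mvar: "diff_act (mvar i) F = pdiff i F"
  by (simp add: mvar_def diff_act_single pdiff_monom_single mconst_def)

lemma diff_act_mconst: "diff_act (mconst c) F = mconst c * F"
  by (simp add: mconst_def diff_act_single)

definition op_ring :: "('v, 'k::comm_ring_1) mpoly ring" where
  "op_ring = \<lparr>carrier = UNIV, monoid.mult = (*), one = 1, zero = 0, add = (+)\<rparr>"

definition ann :: "('v, 'k::comm_ring_1) mpoly \<Rightarrow> ('v, 'k) mpoly set" where
  "ann F = {a. diff_act a F = 0}"

definition alg :: "('v, 'k::comm_ring_1) mpoly \<Rightarrow> ('v, 'k) mpoly set ring" where
  "alg F = op_ring Quot ann F"

definition alg_class :: "('v, 'k::comm_ring_1) mpoly \<Rightarrow> ('v, 'k) mpoly \<Rightarrow> ('v, 'k) mpoly set" where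
  "alg_class F a = ann F +>\<^bsub>op_ring\<^esub> a"

text \<open>The copy of the ground field inside \<open>alg F\<close>, with respect to which linear independence,
  spans and dimensions are taken.\<close>

definition alg_scalars :: "('v, 'k::comm_ring_1) mpoly \<Rightarrow> ('v, 'k) mpoly set set" where
  "alg_scalars F = range (\<lambda>c. alg_class F (mconst c))"

definition alg_graded :: "('v, 'k::comm_ring_1) mpoly \<Rightarrow> nat \<Rightarrow> ('v, 'k) mpoly set set" where
  "alg_graded F d = alg_class F ` {a. homogeneous d a}"

lemma cring_op_ring: "cring op_ring"
proof (rule cringI)
  show "abelian_group (op_ring :: ('v, 'k::comm_ring_1) mpoly ring)"
  proof (rule abelian_groupI)
    fix x :: "('v, 'k) mpoly"
    have "-x + x = 0" by simp
    then show "\<exists>y\<in>carrier op_ring. y \<oplus>\<^bsub>op_ring\<^esub> x = \<zero>\<^bsub>op_ring\<^esub>"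
      by (intro bexI[of _ "- x"]) (simp_all add: op_ring_def)
  qed (simp_all add: op_ring_def ac_simps)
  show "comm_monoid (op_ring :: ('v, 'k::comm_ring_1) mpoly ring)"
    by (rule comm_monoidI) (simp_all add: op_ring_def ac_simps)
qed (simp add: op_ring_def algebra_simps)

lemma ideal_ann: "ideal (ann F) op_ring"
proof -
  interpret cring op_ring by (rule cring_op_ring)
  have minv: "\<ominus>\<^bsub>op_ring\<^esub> x = - x" for x :: "('a, 'b) mpoly"
    by (rule minus_equality) (simp_all add: op_ring_def)
  have neg: "diff_act (- x) F = - diff_act x F" for x
    using diff_act_add_left[of "-x" x F] by (simp add: eq_neg_iff_add_eq_0)
  show ?thesis
  proof (rule idealI)
    show "ring op_ring" by (rule ring_axioms)
    show "subgroup (ann F) (add_monoid op_ring)"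
    proof (rule add.subgroupI)
      show "ann F \<noteq> {}" unfolding ann_def using diff_act_0_left by blast
      fix a assume "a \<in> ann F"
      then show "\<ominus>\<^bsub>op_ring\<^esub> a \<in> ann F"
        by (simp add: minv ann_def neg)
    qed (auto simp: op_ring_def ann_def diff_act_add_left)
    show "x \<otimes>\<^bsub>op_ring\<^esub> a \<in> ann F" "a \<otimes>\<^bsub>op_ring\<^esub> x \<in> ann F"
      if "a \<in> ann F" "x \<in> carrier op_ring" for a x
      using that diff_act_mult[of x a F] by (simp_all add: op_ring_def ann_def mult.commute)
  qed
qed

lemma ring_alg: "ring (alg F)"
  unfolding alg_def by (rule ideal.quotient_is_ring[OF ideal_ann])

definition lin_indep_in_alg :: "('v, 'k::field) mpoly \<Rightarrow> ('v, 'k) mpoly list \<Rightarrow> bool" where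
  "lin_indep_in_alg F as \<longleftrightarrow>
     ring.independent (alg F) (alg_scalars F) (map (alg_class F) as)"

definition graded_basis :: "('v, 'k::field) mpoly \<Rightarrow> nat \<Rightarrow> ('v, 'k) mpoly list \<Rightarrow> bool" where
  "graded_basis F d as \<longleftrightarrow>
     (\<forall>a\<in>set as. homogeneous d a) \<and> lin_indep_in_alg F as \<and>
     ring.Span (alg F) (alg_scalars F) (map (alg_class F) as) = alg_graded F d"

definition has_hilbert_function :: "('v, 'k::field) mpoly \<Rightarrow> (nat \<Rightarrow> nat) \<Rightarrow> bool" where
  "has_hilbert_function F h \<longleftrightarrow>
     (\<forall>d. ring.dimension (alg F) (h d) (alg_scalars F) (alg_graded F d))"

text \<open>For homogeneous \<open>F \<noteq> 0\<close> the socle degree of \<open>alg F\<close> is the degree of \<open>F\<close>.\<close>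

definition weak_lefschetz :: "('v, 'k::field) mpoly \<Rightarrow> bool" where
  "weak_lefschetz F \<longleftrightarrow>
     (\<exists>L\<in>alg_graded F 1. \<forall>i<total_degree F.
        inj_on (\<lambda>a. L \<otimes>\<^bsub>alg F\<^esub> a) (alg_graded F i) \<or>
        (\<lambda>a. L \<otimes>\<^bsub>alg F\<^esub> a) ` alg_graded F i = alg_graded F (i + 1))"

definition hessian :: "('v, 'k::comm_ring_1) mpoly list \<Rightarrow> ('v, 'k) mpoly \<Rightarrow> ('v, 'k) mpoly" where
  "hessian as F =
     det (mat (length as) (length as) (\<lambda>(i, j). diff_act (as ! i * as ! j) F))"

datatype var5 = Var_u | Var_v | Var_x | Var_y | Var_z

end

(* F has degree 3 in u, v and degree 2 in x, y, z, and X^2, XY, Y^2, Z^2 map F to a basis of the cubic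
   forms in u, v. These four operators pair trivially with every basis element of A_2 except
   U^2, UV, V^2, so the second Hessian matrix has four rows supported on three columns and its
   determinant vanishes. For L = aU + bV + ... some combination q of the four has
   qF = 2 (bu - av)^3, so Lq = 0 and multiplication by L is not injective on A_2; it is not surjective
   either, since q L A_2 = 0 while q A_3 is nonzero. If a = b = 0, then q = X^2 serves. *)

theory Submission
  imports Defs
begin

section \<open>Polynomials and differential operators\<close>

text \<open>The map a -> aF identifies A with the space of all derivatives of F, so every claim
  about A turns into one about polynomials. Of the fifteen quadratic monomials in the operators
  exactly UZ, XZ and YZ kill F; the other twelve stay independent. Independence in degree d is
  certified by operators of degree 5 - d, through the pairing (b, a) -> baF with values in k.
  Spanning is certified by closure under differentiation, so that no general operator has to be
  decomposed. The two halves of the counterexample are one degeneracy: if L has coefficient vector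
  p, then the second Hessian at p is det(a_i a_j L F), the determinant of multiplication by L from
  A_2 to A_3 in dual bases. The cube (bu - av)^3 enters because it is, up to a scalar, the only
  cubic form in u, v that aU + bV kills, and the four operators reach every cubic form in u,
  v.\<close>

lemma pdiff_single:
  "pdiff i (Poly_Mapping.single m c) =
     Poly_Mapping.single (m - Poly_Mapping.single i 1) (of_nat (Poly_Mapping.lookup m i) * c)"
  by (cases "c = 0") (simp_all add: pdiff_def)

lemma pdiff_mult: "pdiff i (p * q) = pdiff i p * q + p * pdiff i q"
proof (induction p rule: mpoly_induct)
  case (single m c)
  show ?case
  proof (induction q rule: mpoly_induct)
    case (single n d)
    define e where "e = Poly_Mapping.single i (1::nat)"
    \<comment> \<open>Truncated subtraction satisfies this only where the exponent of
      \<open>i\<close> is positive. In the remaining case the coefficient produced by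
      differentiation is zero, so the Leibniz rule survives.\<close>
    have shift: "a - e + b = a + b - e" if "Poly_Mapping.lookup a i \<noteq> 0" for a b
      by (rule poly_mapping_eqI)
        (use that in \<open>auto simp: e_def lookup_add lookup_minus lookup_single when_def\<close>)
    have "Poly_Mapping.single (m - e + n) (of_nat (Poly_Mapping.lookup m i) * c * d) =
        Poly_Mapping.single (m + n - e) (of_nat (Poly_Mapping.lookup m i) * c * d)"
      by (cases "Poly_Mapping.lookup m i = 0") (simp_all add: shift)
    moreover have "Poly_Mapping.single (m + (n - e)) (c * (of_nat (Poly_Mapping.lookup n i) * d)) =
        Poly_Mapping.single (m + n - e) (c * (of_nat (Poly_Mapping.lookup n i) * d))"
      using shift[of n m] by (cases "Poly_Mapping.lookup n i = 0") (simp_all add: add.commute)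
    ultimately show ?case
      by (simp only: mult_single pdiff_single lookup_add e_def[symmetric])
        (simp add: single_add[symmetric] algebra_simps)
  next
    case (add q q')
    then show ?case by (simp add: distrib_left pdiff_add algebra_simps)
  qed
next
  case (add p p')
  then show ?case by (simp add: distrib_right pdiff_add algebra_simps)
qed

lemma pdiff_mconst: "pdiff i (mconst c) = 0"
  by (simp add: mconst_def pdiff_single)

lemma mconst_1: "mconst 1 = 1"
  by (simp add: mconst_def)

lemma mconst_numeral: "mconst (numeral n) = numeral n"
  by (simp add: mconst_def)

lemma mconst_power: "mconst (c ^ n) = mconst c ^ n"
  by (induction n) (simp_all add: mconst_1 mconst_mult)

lemma pdiff_zero: "pdiff i 0 = 0"
  using pdiff_mconst[of i 0] by simp

lemma pdiff_one: "pdiff i 1 = 0"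
  using pdiff_mconst[of i 1] by (simp add: mconst_1)

lemma pdiff_numeral: "pdiff i (numeral n) = 0"
  using pdiff_mconst[of i "numeral n"] by (simp add: mconst_numeral)

lemma pdiff_uminus: "pdiff i (- p) = - pdiff i p"
  by (rule poly_mapping_eqI) (simp add: lookup_pdiff)

lemma pdiff_diff: "pdiff i (p - q) = pdiff i p - pdiff i q"
  using pdiff_add[of i p "- q"] by (simp add: pdiff_uminus)

lemma pdiff_power: "pdiff i (p ^ n) = of_nat n * p ^ (n - 1) * pdiff i p"
proof (induction n)
  case (Suc n)
  then show ?case by (cases n) (simp_all add: pdiff_mult pdiff_one algebra_simps)
qed (simp add: pdiff_one)

lemma pdiff_mvar: "pdiff i (mvar j) = (if i = j then 1 else 0)"
  by (simp add: mvar_def pdiff_single lookup_single when_def)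

lemmas pdiff_simps = pdiff_zero pdiff_one pdiff_numeral pdiff_mconst pdiff_add pdiff_diff
  pdiff_uminus pdiff_mult pdiff_power

lemma diff_act_1: "diff_act 1 F = F"
  using diff_act_mconst[of 1 F] by (simp add: mconst_1)

lemma diff_act_power: "diff_act (a ^ n) F = (diff_act a ^^ n) F"
  by (induction n) (simp_all add: diff_act_1 diff_act_mult)

lemma diff_act_numeral: "diff_act (numeral n) F = numeral n * F"
  using diff_act_mconst[of "numeral n" F] by (simp add: mconst_numeral)

lemma diff_act_uminus: "diff_act (- a) F = - diff_act a F"
  using diff_act_add_left[of "- a" a F] by (simp add: eq_neg_iff_add_eq_0)

lemma diff_act_diff: "diff_act (a - b) F = diff_act a F - diff_act b F"
  using diff_act_add_left[of a "- b" F] by (simp add: diff_act_uminus)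

lemmas diff_act_simps = diff_act_1 diff_act_numeral diff_act_mconst diff_act_add_left
  diff_act_diff diff_act_uminus diff_act_mult diff_act_power diff_act_mvar

subsection \<open>Evaluation\<close>

definition monom_eval :: "('v \<Rightarrow> 'k::comm_ring_1) \<Rightarrow> ('v \<Rightarrow>\<^sub>0 nat) \<Rightarrow> 'k" where
  "monom_eval f m = (\<Prod>i\<in>Poly_Mapping.keys m. f i ^ Poly_Mapping.lookup m i)"

text \<open>Evaluation serves twice: at a suitable point it shows that a polynomial is nonzero, and
  at the origin it reads the scalar off a constant pairing.\<close>

definition mpoly_eval :: "('v \<Rightarrow> 'k::comm_ring_1) \<Rightarrow> ('v, 'k) mpoly \<Rightarrow> 'k" where
  "mpoly_eval f p = (\<Sum>m\<in>Poly_Mapping.keys p. Poly_Mapping.lookup p m * monom_eval f m)"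

lemma monom_eval_superset:
  assumes "finite A" "Poly_Mapping.keys m \<subseteq> A"
  shows "monom_eval f m = (\<Prod>i\<in>A. f i ^ Poly_Mapping.lookup m i)"
  unfolding monom_eval_def
  by (rule prod.mono_neutral_left) (use assms in \<open>auto simp: in_keys_iff\<close>)

lemma monom_eval_add: "monom_eval f (m + n) = monom_eval f m * monom_eval f n"
  using keys_add[of m n]
  by (simp add: monom_eval_superset[of "Poly_Mapping.keys m \<union> Poly_Mapping.keys n"]
      lookup_add power_add prod.distrib)

lemma mpoly_eval_single: "mpoly_eval f (Poly_Mapping.single m c) = c * monom_eval f m"
  by (cases "c = 0") (simp_all add: mpoly_eval_def)

lemma mpoly_eval_superset:
  assumes "finite M" "Poly_Mapping.keys p \<subseteq> M"
  shows "mpoly_eval f p = (\<Sum>m\<in>M. Poly_Mapping.lookup p m * monom_eval f m)"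
  unfolding mpoly_eval_def
  by (rule sum.mono_neutral_left) (use assms in \<open>auto simp: in_keys_iff\<close>)

lemma mpoly_eval_add: "mpoly_eval f (p + q) = mpoly_eval f p + mpoly_eval f q"
  using keys_add[of p q]
  by (simp add: mpoly_eval_superset[of "Poly_Mapping.keys p \<union> Poly_Mapping.keys q"]
      lookup_add sum.distrib algebra_simps)

lemma mpoly_eval_mult: "mpoly_eval f (p * q) = mpoly_eval f p * mpoly_eval f q"
proof (induction p rule: mpoly_induct)
  case (single m c)
  show ?case
    by (induction q rule: mpoly_induct)
      (simp_all add: mult_single mpoly_eval_single monom_eval_add mpoly_eval_add algebra_simps)
qed (simp add: mpoly_eval_add algebra_simps)

lemma mpoly_eval_mconst: "mpoly_eval f (mconst c) = c"
  by (simp add: mconst_def mpoly_eval_single monom_eval_def)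

lemma mpoly_eval_mvar: "mpoly_eval f (mvar i) = f i"
  by (simp add: mvar_def mpoly_eval_single monom_eval_def)

lemma mpoly_eval_zero: "mpoly_eval f 0 = 0"
  using mpoly_eval_mconst[of f 0] by simp

lemma mpoly_eval_one: "mpoly_eval f 1 = 1"
  using mpoly_eval_mconst[of f 1] by (simp add: mconst_1)

lemma mpoly_eval_numeral: "mpoly_eval f (numeral n) = numeral n"
  using mpoly_eval_mconst[of f "numeral n"] by (simp add: mconst_numeral)

lemma mpoly_eval_uminus: "mpoly_eval f (- p) = - mpoly_eval f p"
  using mpoly_eval_add[of f "- p" p] by (simp add: eq_neg_iff_add_eq_0 mpoly_eval_zero)

lemma mpoly_eval_power: "mpoly_eval f (p ^ n) = mpoly_eval f p ^ n"
  by (induction n) (simp_all add: mpoly_eval_one mpoly_eval_mult)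

lemmas mpoly_eval_simps = mpoly_eval_add mpoly_eval_mult mpoly_eval_mconst mpoly_eval_mvar
  mpoly_eval_zero mpoly_eval_one mpoly_eval_numeral mpoly_eval_uminus mpoly_eval_power

subsection \<open>Homogeneity\<close>

lemma mdeg_superset:
  assumes "finite A" "Poly_Mapping.keys m \<subseteq> A"
  shows "mdeg m = (\<Sum>i\<in>A. Poly_Mapping.lookup m i)"
  unfolding mdeg_def
  by (rule sum.mono_neutral_left) (use assms in \<open>auto simp: in_keys_iff\<close>)

lemma mdeg_add: "mdeg (m + n) = mdeg m + mdeg n"
  using keys_add[of m n]
  by (simp add: mdeg_superset[of "Poly_Mapping.keys m \<union> Poly_Mapping.keys n"]
      lookup_add sum.distrib)

lemma homogeneous_add:
  "homogeneous d p \<Longrightarrow> homogeneous d q \<Longrightarrow> homogeneous d (p + q)"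
  unfolding homogeneous_def using keys_add[of p q] by fastforce

lemma homogeneous_mult:
  "homogeneous d p \<Longrightarrow> homogeneous e q \<Longrightarrow> homogeneous (d + e) (p * q)"
proof (unfold homogeneous_def, rule ballI)
  assume *: "\<forall>m\<in>Poly_Mapping.keys p. mdeg m = d" "\<forall>m\<in>Poly_Mapping.keys q. mdeg m = e"
  fix m assume "m \<in> Poly_Mapping.keys (p * q)"
  then obtain a b where "m = a + b" "a \<in> Poly_Mapping.keys p" "b \<in> Poly_Mapping.keys q"
    using keys_mult[of p q] by blast
  then show "mdeg m = d + e" using * by (simp add: mdeg_add)
qed

lemma homogeneous_mconst: "homogeneous 0 (mconst c)"
  by (simp add: homogeneous_def mconst_def mdeg_def)

lemma homogeneous_zero: "homogeneous d 0"
  by (simp add: homogeneous_def)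

lemma homogeneous_mvar: "homogeneous 1 (mvar i)"
  by (simp add: homogeneous_def mvar_def mdeg_def)

lemma homogeneous_scale: "homogeneous d p \<Longrightarrow> homogeneous d (mconst c * p)"
  using homogeneous_mult[OF homogeneous_mconst] by fastforce

lemma homogeneous_numeral_mult: "homogeneous d p \<Longrightarrow> homogeneous d (numeral n * p)"
  using homogeneous_scale[of d p "numeral n"] by (simp add: mconst_numeral)

lemma homogeneous_uminus: "homogeneous d p \<Longrightarrow> homogeneous d (- p)"
  by (simp add: homogeneous_def)

lemma homogeneous_diff: "homogeneous d p \<Longrightarrow> homogeneous d q \<Longrightarrow> homogeneous d (p - q)"
  using homogeneous_add[OF _ homogeneous_uminus] by fastforce

lemma homogeneous_power: "homogeneous d p \<Longrightarrow> homogeneous (n * d) (p ^ n)"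
proof (induction n)
  case 0
  show ?case using homogeneous_mconst[of 1] by (simp add: mconst_1)
qed (simp add: homogeneous_mult)

lemma homogeneous_mvar_power: "homogeneous n (mvar i ^ n)"
  using homogeneous_power[OF homogeneous_mvar, of n i] by simp

lemma total_degree_homogeneous:
  assumes "homogeneous d p" "p \<noteq> 0"
  shows "total_degree p = d"
proof -
  have "mdeg ` Poly_Mapping.keys p = {d}"
    using assms by (auto simp: homogeneous_def image_iff) (metis keys_eq_empty ex_in_conv)
  then show ?thesis by (simp add: total_degree_def)
qed


section \<open>Linear algebra in the quotient\<close>

text \<open>Scalar multiplication in the form that \<open>vector_space\<close> expects, which makes
  \<open>mpoly.span\<close> and its calculus available for derivatives of F.\<close>

definition mscale :: "'k::field \<Rightarrow> ('v, 'k) mpoly \<Rightarrow> ('v, 'k) mpoly" where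
  "mscale c p = mconst c * p"

interpretation mpoly: vector_space mscale
  by standard (simp_all add: mscale_def mconst_add mconst_mult mconst_1 algebra_simps)

interpretation diff_act: module_hom mscale mscale "diff_act a"
  by standard (simp_all add: mscale_def diff_act_add_right diff_act_scale)

interpretation diff_act_left: module_hom mscale mscale "\<lambda>a. diff_act a F"
  by standard (simp_all add: mscale_def diff_act_add_left diff_act_mult diff_act_mconst)

lemma span_numeral_mult: "p \<in> mpoly.span S \<Longrightarrow> numeral n * p \<in> mpoly.span S"
  using mpoly.span_scale[of p S "numeral n"] by (simp add: mscale_def mconst_numeral)

text \<open>These are the shapes of a normalized derivative with a numeral coefficient: the
  coefficient stands last in the product, or alone when the monomial is 1.\<close>

lemma span_numeral:
  "p \<in> mpoly.span S \<Longrightarrow> p * numeral n \<in> mpoly.span S"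
  "p * q \<in> mpoly.span S \<Longrightarrow> p * (q * numeral n) \<in> mpoly.span S"
  "1 \<in> mpoly.span S \<Longrightarrow> numeral n \<in> mpoly.span S"
  using span_numeral_mult[of p S n] span_numeral_mult[of "p * q" S n] span_numeral_mult[of 1 S n]
  by (simp_all add: ac_simps)

text \<open>Characteristic zero allows division by the numeral, so a listed multiple of a monomial
  yields the monomial itself.\<close>

lemma span_cancel_numeral:
  fixes p :: "('v, 'k::field_char_0) mpoly"
  assumes "numeral n * p \<in> S"
  shows "p \<in> mpoly.span S"
proof -
  have "mscale (1 / numeral n) (numeral n * p) = mconst (1 / numeral n * numeral n) * p"
    by (simp only: mscale_def mconst_mult mconst_numeral mult.assoc)
  then have "mscale (1 / numeral n) (numeral n * p) = p"
    by (simp add: mconst_1)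
  then show ?thesis
    using mpoly.span_scale[OF mpoly.span_base[OF assms]] by metis
qed

text \<open>Applying \<open>b\<close> and then evaluating is a linear functional; one that vanishes
  on \<open>S\<close> vanishes on its span.\<close>

lemma not_in_span_if_functional:
  assumes "mpoly_eval f (diff_act b p) \<noteq> 0"
    and "\<And>q. q \<in> S \<Longrightarrow> mpoly_eval f (diff_act b q) = 0"
  shows "p \<notin> mpoly.span S"
proof
  assume "p \<in> mpoly.span S"
  then have "mpoly_eval f (diff_act b p) = 0"
    by (induction rule: mpoly.span_induct_alt)
      (simp_all add: assms(2) diff_act_add_right diff_act_scale mscale_def mpoly_eval_simps)
  with assms(1) show False by simp
qed

text \<open>\<open>ann F\<close> is the kernel of a -> aF. This is the bridge from the quotient to
  polynomials.\<close>

lemma alg_class_eq_iff: "alg_class F a = alg_class F b \<longleftrightarrow> diff_act a F = diff_act b F"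
proof -
  interpret ideal "ann F" op_ring by (rule ideal_ann)
  have "\<ominus>\<^bsub>op_ring\<^esub> b = - b"
    by (rule minus_equality) (simp_all add: op_ring_def)
  then have "a \<ominus>\<^bsub>op_ring\<^esub> b = a - b"
    by (simp add: a_minus_def) (simp add: op_ring_def)
  then show ?thesis
    using quotient_eq_iff_same_a_r_cos[OF ideal_ann, of a b]
    by (auto simp: op_ring_def alg_class_def ann_def diff_act_diff)
qed

lemma alg_class_add: "alg_class F a \<oplus>\<^bsub>alg F\<^esub> alg_class F b = alg_class F (a + b)"
proof -
  interpret ideal "ann F" op_ring by (rule ideal_ann)
  show ?thesis
    using a_rcos_sum[of a b] by (simp add: alg_def FactRing_def alg_class_def op_ring_def)
qed

lemma alg_class_mult: "alg_class F a \<otimes>\<^bsub>alg F\<^esub> alg_class F b = alg_class F (a * b)"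
proof -
  interpret ideal "ann F" op_ring by (rule ideal_ann)
  show ?thesis
    using rcoset_mult_add[of a b] by (simp add: alg_def FactRing_def alg_class_def op_ring_def)
qed

lemma alg_class_0: "alg_class F 0 = \<zero>\<^bsub>alg F\<^esub>"
proof -
  interpret ideal "ann F" op_ring by (rule ideal_ann)
  show ?thesis
    using a_coset_add_zero[of "ann F"] by (simp add: alg_def FactRing_def alg_class_def op_ring_def)
qed

lemma alg_class_closed: "alg_class F a \<in> carrier (alg F)"
  unfolding alg_def FactRing_def alg_class_def A_RCOSETS_def' by (auto simp: op_ring_def)

text \<open>\<open>Span\<close> recurses over the list and adds the multiples of one vector at a
  time. \<open>mpoly.span_insert\<close> decomposes a span in the same way, so both sides follow one
  induction, and spans in the quotient reduce to spans of operators.\<close>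

lemma alg_Span:
  "ring.Span (alg F) (alg_scalars F) (map (alg_class F) as) = alg_class F ` mpoly.span (set as)"
proof -
  interpret ring "alg F" by (rule ring_alg)
  show ?thesis
  proof (induction as)
    case Nil
    show ?case by (simp add: alg_class_0)
  next
    case (Cons a as)
    have line: "x \<in> line_extension (alg_scalars F) (alg_class F a) (alg_class F ` T) \<longleftrightarrow>
        (\<exists>c. \<exists>b\<in>T. x = alg_class F (mscale c a + b))" for x T
      by (simp add: line_extension_def set_add_def' r_coset_def alg_scalars_def mscale_def
          alg_class_mult alg_class_add)
    have span: "p \<in> mpoly.span (set (a # as)) \<longleftrightarrow>
        (\<exists>c. \<exists>b\<in>mpoly.span (set as). p = mscale c a + b)" for p
    proof
      assume "p \<in> mpoly.span (set (a # as))"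
      then obtain c where "p - mscale c a \<in> mpoly.span (set as)"
        by (auto simp: mpoly.span_insert)
      then show "\<exists>c. \<exists>b\<in>mpoly.span (set as). p = mscale c a + b"
        by (intro exI[of _ c] bexI[of _ "p - mscale c a"]) simp_all
    next
      assume "\<exists>c. \<exists>b\<in>mpoly.span (set as). p = mscale c a + b"
      then obtain c b where "b \<in> mpoly.span (set as)" "p = mscale c a + b" by blast
      then have "p - mscale c a \<in> mpoly.span (set as)" by simp
      then show "p \<in> mpoly.span (set (a # as))"
        unfolding list.set mpoly.span_insert by blast
    qed
    have "Span (alg_scalars F) (map (alg_class F) (a # as)) =
        line_extension (alg_scalars F) (alg_class F a) (alg_class F ` mpoly.span (set as))"
      using Cons by simp
    also have "\<dots> = alg_class F ` mpoly.span (set (a # as))"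
    proof (rule Set.set_eqI)
      fix x
      show "x \<in> line_extension (alg_scalars F) (alg_class F a) (alg_class F ` mpoly.span (set as)) \<longleftrightarrow>
          x \<in> alg_class F ` mpoly.span (set (a # as))"
        unfolding line image_iff Bex_def span by metis
    qed
    finally show ?case .
  qed
qed

lemma lin_indep_in_alg_Nil: "lin_indep_in_alg F []"
proof -
  interpret ring "alg F" by (rule ring_alg)
  show ?thesis by (simp add: lin_indep_in_alg_def)
qed

lemma lin_indep_in_alg_ConsI:
  assumes "diff_act a F \<notin> mpoly.span ((\<lambda>a. diff_act a F) ` set as)" "lin_indep_in_alg F as"
  shows "lin_indep_in_alg F (a # as)"
proof -
  interpret ring "alg F" by (rule ring_alg)
  have "alg_class F a \<notin> Span (alg_scalars F) (map (alg_class F) as)"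
    using assms(1) unfolding alg_Span diff_act_left.span_image by (auto simp: alg_class_eq_iff)
  then show ?thesis
    using assms(2) li_Cons[OF alg_class_closed]
    by (simp add: lin_indep_in_alg_def del: Span.simps)
qed

text \<open>The matrix of pairings is triangular with nonzero diagonal: each \<open>b\<close>
  detects its own \<open>a\<close> and kills all later ones, so it separates the head of the list
  from the span of the tail.\<close>

lemma lin_indep_in_alg_triangular:
  assumes "length bs = length as"
    and "list_all (\<lambda>(b, a). mpoly_eval f (diff_act b (diff_act a F)) \<noteq> 0) (zip bs as)"
    and "sorted_wrt (\<lambda>(b, a) (b', a'). mpoly_eval f (diff_act b (diff_act a' F)) = 0) (zip bs as)"
  shows "lin_indep_in_alg F as"
  using assms
proof (induction bs as rule: list_induct2)
  case (Cons b bs a as)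
  have "mpoly_eval f (diff_act b (diff_act a' F)) = 0" if "a' \<in> set as" for a'
  proof -
    obtain b' where "(b', a') \<in> set (zip bs as)"
      using \<open>a' \<in> set as\<close> Cons.hyps by (metis in_set_impl_in_set_zip2)
    then show ?thesis using Cons.prems by auto
  qed
  then have "diff_act a F \<notin> mpoly.span ((\<lambda>a. diff_act a F) ` set as)"
    by (intro not_in_span_if_functional[of f b]) (use Cons.prems in auto)
  then show ?case
    by (rule lin_indep_in_alg_ConsI) (use Cons in simp)
qed (rule lin_indep_in_alg_Nil)

lemma graded_basisI:
  assumes "list_all (homogeneous d) as" "lin_indep_in_alg F as"
    and span: "\<And>a. homogeneous d a \<Longrightarrow> diff_act a F \<in> mpoly.span ((\<lambda>a. diff_act a F) ` set as)"
  shows "graded_basis F d as"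
proof -
  have hom: "homogeneous d a" if "a \<in> mpoly.span (set as)" for a
    using that
    by (induction rule: mpoly.span_induct_alt)
      (use assms(1) in \<open>auto simp: list_all_iff mscale_def homogeneous_zero
         intro: homogeneous_add homogeneous_scale\<close>)
  have "alg_class F ` mpoly.span (set as) = alg_graded F d"
  proof
    show "alg_graded F d \<subseteq> alg_class F ` mpoly.span (set as)"
      using span unfolding alg_graded_def diff_act_left.span_image
      by (auto simp: image_iff alg_class_eq_iff)
  qed (auto simp: alg_graded_def hom)
  then show ?thesis
    using assms(1,2) by (simp add: graded_basis_def alg_Span list_all_iff)
qed

lemma graded_basis_imp_dimension:
  assumes "graded_basis F d as"
  shows "ring.dimension (alg F) (length as) (alg_scalars F) (alg_graded F d)"
proof -
  interpret ring "alg F" by (rule ring_alg)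
  show ?thesis
    using assms dimension_independent[of "alg_scalars F" "map (alg_class F) as"]
    by (simp add: graded_basis_def lin_indep_in_alg_def del: Span.simps)
qed

text \<open>An operator of degree d is a combination of d-fold partial derivatives. If each family
  maps into the span of the next one, then d differentiations lead from \<open>F\<close> into the
  span of \<open>B d\<close>, and only the generators have to be checked.\<close>

lemma diff_act_homogeneous_in_span:
  fixes F :: "('v, 'k::field) mpoly"
  assumes 0: "F \<in> mpoly.span (B 0)"
    and Suc: "\<And>d p i. p \<in> B d \<Longrightarrow> pdiff i p \<in> mpoly.span (B (Suc d))"
    and a: "homogeneous d a"
  shows "diff_act a F \<in> mpoly.span (B d)"
proof -
  have step: "pdiff i p \<in> mpoly.span (B (Suc d))" if "p \<in> mpoly.span (B d)" for d i p
  proof -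
    have "diff_act (mvar i) p \<in> diff_act (mvar i) ` mpoly.span (B d)" using that by blast
    also have "\<dots> = mpoly.span (diff_act (mvar i) ` B d)" by (simp add: diff_act.span_image)
    also have "\<dots> \<subseteq> mpoly.span (B (Suc d))"
      by (rule mpoly.span_minimal) (auto simp: diff_act_mvar Suc)
    finally show ?thesis by (simp add: diff_act_mvar)
  qed
  have monom: "pdiff_monom m F \<in> mpoly.span (B d)" if "mdeg m = d" for m d
    using that
  proof (induction d arbitrary: m)
    case 0
    have "Poly_Mapping.keys m = {}"
    proof (rule equals0I)
      fix i assume "i \<in> Poly_Mapping.keys m"
      moreover from this have "Poly_Mapping.lookup m i = 0"
        using 0 by (simp add: mdeg_def)
      ultimately show False by (simp add: in_keys_iff)
    qed
    then have "m = 0" by simp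
    then show ?case using assms(1) by simp
  next
    case (Suc d)
    have "\<exists>i. Poly_Mapping.lookup m i \<noteq> 0"
    proof (rule ccontr)
      assume "\<nexists>i. Poly_Mapping.lookup m i \<noteq> 0"
      then have "mdeg m = 0" by (simp add: mdeg_def)
      with Suc.prems show False by simp
    qed
    then obtain i where i: "Poly_Mapping.lookup m i \<noteq> 0" by blast
    define n where "n = m - Poly_Mapping.single i 1"
    have m: "m = Poly_Mapping.single i 1 + n"
      by (rule poly_mapping_eqI)
        (use i in \<open>auto simp: n_def lookup_add lookup_minus lookup_single when_def\<close>)
    have "mdeg m = Suc (mdeg n)"
      unfolding m mdeg_add by (simp add: mdeg_def)
    with Suc have "pdiff_monom n F \<in> mpoly.span (B d)" by simp
    then have "pdiff i (pdiff_monom n F) \<in> mpoly.span (B (Suc d))" by (rule step)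
    moreover have "pdiff_monom m F = pdiff i (pdiff_monom n F)"
      unfolding m by (simp only: pdiff_monom_add pdiff_monom_single) simp
    ultimately show ?case by simp
  qed
  show ?thesis
    unfolding diff_act_def mscale_def[symmetric]
    by (intro mpoly.span_sum mpoly.span_scale monom) (use a in \<open>simp add: homogeneous_def\<close>)
qed

section \<open>Determinants\<close>

text \<open>Pigeonhole: a permutation cannot map the rows \<open>R\<close> into the smaller set of
  columns \<open>C\<close>, so every term of the Leibniz formula contains a zero factor.\<close>

lemma det_mat_zero_block:
  fixes f :: "nat \<times> nat \<Rightarrow> 'a::comm_ring_1"
  assumes R: "R \<subseteq> {..<n}" and C: "finite C" "card C < card R"
    and 0: "\<And>i j. i \<in> R \<Longrightarrow> j < n \<Longrightarrow> j \<notin> C \<Longrightarrow> f (i, j) = 0"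
  shows "det (mat n n f) = 0"
proof -
  have "(\<Prod>i = 0..<n. mat n n f $$ (i, p i)) = 0" if p: "p permutes {0..<n}" for p
  proof -
    have "\<not> p ` R \<subseteq> C"
    proof
      assume "p ` R \<subseteq> C"
      then have "card (p ` R) \<le> card C" using C(1) by (rule card_mono[rotated])
      moreover have "card (p ` R) = card R"
        by (rule card_image) (use permutes_inj[OF p] in \<open>auto intro: inj_on_subset\<close>)
      ultimately show False using C(2) by simp
    qed
    then obtain i where i: "i \<in> R" "p i \<notin> C" by blast
    then have "i < n" using R by auto
    moreover have "p i < n" using permutes_in_image[OF p, of i] \<open>i < n\<close> by simp
    ultimately have "mat n n f $$ (i, p i) = 0" using i 0 \<open>i < n\<close> by simp
    then show ?thesis using \<open>i < n\<close> by (intro prod_zero) auto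
  qed
  then show ?thesis by (simp add: det_def)
qed

text \<open>Writing the minor again as a \<open>mat\<close>, with the columns from \<open>j\<close>
  on shifted by one, lets the expansion along the first row be iterated for concrete sizes.\<close>

lemma det_mat_Suc:
  fixes f :: "nat \<times> nat \<Rightarrow> 'a::comm_ring_1"
  shows "det (mat (Suc n) (Suc n) f) = (\<Sum>j<Suc n. (- 1) ^ j * f (0, j) *
      det (mat n n (\<lambda>(i, k). f (Suc i, if k < j then k else Suc k))))"
proof -
  have "mat_delete (mat (Suc n) (Suc n) f) 0 j =
      mat n n (\<lambda>(i, k). f (Suc i, if k < j then k else Suc k))" for j
    by (rule eq_matI) (auto simp: mat_delete_def)
  then show ?thesis
    by (subst laplace_expansion_row[of _ "Suc n" 0])
      (auto simp: cofactor_def algebra_simps intro!: sum.cong)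
qed

lemma det_mat_0: "det (mat 0 0 f) = 1"
  by (simp add: det_def)

lemma det_mat_2:
  fixes f :: "nat \<times> nat \<Rightarrow> 'a::comm_ring_1"
  shows "det (mat 2 2 f) =
    f (0, 0) * f (1, 1) - f (0, 1) * f (1, 0)"
  using det_mat_Suc[of "Suc 0" f]
  by (simp add: det_mat_Suc[of 0] det_mat_0 lessThan_nat_numeral lessThan_Suc algebra_simps
      numeral_2_eq_2)

lemma det_mat_3:
  fixes f :: "nat \<times> nat \<Rightarrow> 'a::comm_ring_1"
  shows "det (mat 3 3 f) =
    f (0, 0) * (f (1, 1) * f (2, 2) - f (1, 2) * f (2, 1))
    - f (0, 1) * (f (1, 0) * f (2, 2) - f (1, 2) * f (2, 0))
    + f (0, 2) * (f (1, 0) * f (2, 1) - f (1, 1) * f (2, 0))"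
  using det_mat_Suc[of 2 f]
  by (simp add: det_mat_2 lessThan_nat_numeral lessThan_Suc algebra_simps
      numeral_2_eq_2[symmetric])

lemma det_mat_4:
  fixes f :: "nat \<times> nat \<Rightarrow> 'a::comm_ring_1"
  shows "det (mat 4 4 f) =
    f (0, 0) * (f (1, 1) * (f (2, 2) * f (3, 3) - f (2, 3) * f (3, 2))
        - f (1, 2) * (f (2, 1) * f (3, 3) - f (2, 3) * f (3, 1))
        + f (1, 3) * (f (2, 1) * f (3, 2) - f (2, 2) * f (3, 1)))
    - f (0, 1) * (f (1, 0) * (f (2, 2) * f (3, 3) - f (2, 3) * f (3, 2))
        - f (1, 2) * (f (2, 0) * f (3, 3) - f (2, 3) * f (3, 0))
        + f (1, 3) * (f (2, 0) * f (3, 2) - f (2, 2) * f (3, 0)))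
    + f (0, 2) * (f (1, 0) * (f (2, 1) * f (3, 3) - f (2, 3) * f (3, 1))
        - f (1, 1) * (f (2, 0) * f (3, 3) - f (2, 3) * f (3, 0))
        + f (1, 3) * (f (2, 0) * f (3, 1) - f (2, 1) * f (3, 0)))
    - f (0, 3) * (f (1, 0) * (f (2, 1) * f (3, 2) - f (2, 2) * f (3, 1))
        - f (1, 1) * (f (2, 0) * f (3, 2) - f (2, 2) * f (3, 0))
        + f (1, 2) * (f (2, 0) * f (3, 1) - f (2, 1) * f (3, 0)))"
  using det_mat_Suc[of 3 f]
  by (simp add: det_mat_3 lessThan_nat_numeral lessThan_Suc algebra_simps
      numeral_2_eq_2[symmetric])

text \<open>This is the shape of the first Hessian in the order U, V, X, Y, Z: since UZ, XZ and YZ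
  kill F, the last row has only the entries \<open>h\<close> = VZF and \<open>l\<close> = Z^2 F. The
  formula is the expansion along that row, arranged by the 2x2 minors of the X and Y rows.\<close>

lemma det_symmetric5:
  fixes a b c d e f g h i j k l :: "'a::comm_ring_1"
  defines "M \<equiv> [[a, b, c, d, 0], [b, e, f, g, h], [c, f, i, j, 0], [d, g, j, k, 0], [0, h, 0, 0, l]]"
  shows "det (mat 5 5 (\<lambda>(i, j). M ! i ! j)) =
    l * (a * (e * (i * k - j^2) - f * (f * k - g * j) + g * (f * j - g * i))
      - b * (b * (i * k - j^2) - f * (c * k - d * j) + g * (c * j - d * i))
      + c * (b * (f * k - g * j) - e * (c * k - d * j) + g * (c * g - d * f))
      - d * (b * (f * j - g * i) - e * (c * j - d * i) + f * (c * g - d * f)))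
    - h^2 * (a * (i * k - j^2) - c * (c * k - d * j) + d * (c * j - d * i))"
  using det_mat_Suc[of 4 "\<lambda>(i, j). M ! i ! j"]
  by (simp add: det_mat_4 M_def lessThan_nat_numeral lessThan_Suc)
    (simp add: algebra_simps power2_eq_square)

section \<open>The quintic\<close>

locale quintic =
  fixes u v x y z U V X Y Z F :: "(var5, 'k::field_char_0) mpoly"
  assumes vars: "u = mvar Var_u" "v = mvar Var_v" "x = mvar Var_x" "y = mvar Var_y" "z = mvar Var_z"
    and ops: "U = mvar Var_u" "V = mvar Var_v" "X = mvar Var_x" "Y = mvar Var_y" "Z = mvar Var_z"
    and F: "F = x^2 * u^3 + x * y * u^2 * v + y^2 * u * v^2 + z^2 * v^3"
begin

section \<open>Explicit derivatives of \<open>F\<close> of each order\<close>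

lemma pdiff_vars:
  "pdiff i u = (if i = Var_u then 1 else 0)" "pdiff i v = (if i = Var_v then 1 else 0)"
  "pdiff i x = (if i = Var_x then 1 else 0)" "pdiff i y = (if i = Var_y then 1 else 0)"
  "pdiff i z = (if i = Var_z then 1 else 0)"
  by (simp_all add: vars pdiff_mvar)

lemma diff_act_ops:
  "diff_act U p = pdiff Var_u p" "diff_act V p = pdiff Var_v p" "diff_act X p = pdiff Var_x p"
  "diff_act Y p = pdiff Var_y p" "diff_act Z p = pdiff Var_z p"
  by (simp_all add: ops diff_act_mvar)

lemma eval_vars:
  "mpoly_eval f u = f Var_u" "mpoly_eval f v = f Var_v" "mpoly_eval f x = f Var_x"
  "mpoly_eval f y = f Var_y" "mpoly_eval f z = f Var_z"
  by (simp_all add: vars mpoly_eval_mvar)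

lemmas D = pdiff_vars pdiff_simps diff_act_simps diff_act_ops

lemma first_derivatives:
  "diff_act U F = 3 * x^2 * u^2 + 2 * x * y * u * v + y^2 * v^2"
  "diff_act V F = x * y * u^2 + 2 * y^2 * u * v + 3 * z^2 * v^2"
  "diff_act X F = 2 * x * u^3 + y * u^2 * v"
  "diff_act Y F = x * u^2 * v + 2 * y * u * v^2"
  "diff_act Z F = 2 * z * v^3"
  by (simp_all add: F D algebra_simps)

lemma second_derivatives:
  "diff_act (U^2) F = 6 * x^2 * u + 2 * x * y * v"
  "diff_act (V^2) F = 2 * y^2 * u + 6 * z^2 * v"
  "diff_act (U * V) F = 2 * x * y * u + 2 * y^2 * v"
  "diff_act (X^2) F = 2 * u^3"
  "diff_act (Y^2) F = 2 * u * v^2"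
  "diff_act (Z^2) F = 2 * v^3"
  "diff_act (X * Y) F = u^2 * v"
  "diff_act (U * X) F = 6 * x * u^2 + 2 * y * u * v"
  "diff_act (U * Y) F = 2 * x * u * v + 2 * y * v^2"
  "diff_act (V * X) F = y * u^2"
  "diff_act (V * Y) F = x * u^2 + 4 * y * u * v"
  "diff_act (V * Z) F = 6 * z * v^2"
  by (simp_all add: power2_eq_square diff_act_mult first_derivatives)
    (simp_all add: D algebra_simps power2_eq_square power3_eq_cube)

lemma third_derivatives:
  "diff_act (X^2 * U) F = 6 * u^2"
  "diff_act (X * Y * U) F = 2 * (u * v)"
  "diff_act (Y^2 * U) F = 2 * v^2"
  "diff_act (2 * X * U^2 - Y * U * V) F = 22 * (u * x)"
  "diff_act (X * U * V) F = 2 * (u * y)"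
  "diff_act (Y * U^2) F = 2 * (v * x)"
  "diff_act (6 * Y * U * V - X * U^2) F = 22 * (v * y)"
  "diff_act (Z * V^2) F = 12 * (v * z)"
  "diff_act (U^3) F = 6 * x^2"
  "diff_act (U^2 * V) F = 2 * (x * y)"
  "diff_act (U * V^2) F = 2 * y^2"
  "diff_act (V^3) F = 6 * z^2"
  by (simp_all add: F D algebra_simps power2_eq_square power3_eq_cube)

lemma fourth_derivatives:
  "diff_act (X * U^3) F = 12 * x"
  "diff_act (X * U^2 * V) F = 2 * y"
  "diff_act (Z * V^3) F = 12 * z"
  "diff_act (X^2 * U^2) F = 12 * u"
  "diff_act (Y^2 * U * V) F = 4 * v"
  by (simp_all add: F D algebra_simps power2_eq_square power3_eq_cube)

lemma fifth_derivative: "diff_act (X^2 * U^3) F = 12"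
  by (simp add: F D algebra_simps power2_eq_square power3_eq_cube)

text \<open>In degree 3, \<open>XU\<^sup>2\<close> and \<open>YUV\<close> map \<open>F\<close> to \<open>12xu + 2yv\<close> and \<open>2xu + 4yv\<close>; the two
  combinations used separate \<open>xu\<close> from \<open>yv\<close>, so that all images are multiples of monomials.\<close>

definition basis :: "nat \<Rightarrow> (var5, 'k) mpoly list" where
  "basis d = (if d < 6 then
     [[1], [U, V, X, Y, Z],
      [U^2, V^2, U * V, X^2, Y^2, Z^2, X * Y, U * X, U * Y, V * X, V * Y, V * Z],
      [X^2 * U, X * Y * U, Y^2 * U, 2 * X * U^2 - Y * U * V, X * U * V, Y * U^2,
       6 * Y * U * V - X * U^2, Z * V^2, U^3, U^2 * V, U * V^2, V^3],
      [X * U^3, X * U^2 * V, Z * V^3, X^2 * U^2, Y^2 * U * V],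
      [X^2 * U^3]] ! d else [])"

abbreviation "img d \<equiv> (\<lambda>a. diff_act a F) ` set (basis d)"

section \<open>Spanning the derivatives of each order\<close>

lemma img:
  "img 0 = {F}"
  "img 1 = {3 * x^2 * u^2 + 2 * x * y * u * v + y^2 * v^2,
     x * y * u^2 + 2 * y^2 * u * v + 3 * z^2 * v^2, 2 * x * u^3 + y * u^2 * v,
     x * u^2 * v + 2 * y * u * v^2, 2 * z * v^3}"
  "img 2 = {6 * x^2 * u + 2 * x * y * v, 2 * y^2 * u + 6 * z^2 * v, 2 * x * y * u + 2 * y^2 * v,
     2 * u^3, 2 * u * v^2, 2 * v^3, u^2 * v, 6 * x * u^2 + 2 * y * u * v,
     2 * x * u * v + 2 * y * v^2, y * u^2, x * u^2 + 4 * y * u * v, 6 * z * v^2}"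
  "img 3 = {6 * u^2, 2 * (u * v), 2 * v^2, 22 * (u * x), 2 * (u * y), 2 * (v * x), 22 * (v * y),
     12 * (v * z), 6 * x^2, 2 * (x * y), 2 * y^2, 6 * z^2}"
  "img 4 = {12 * x, 2 * y, 12 * z, 12 * u, 4 * v}"
  "img 5 = {12}"
  by (simp_all add: basis_def first_derivatives second_derivatives third_derivatives
      fourth_derivatives fifth_derivative diff_act_1)

lemma img_empty: "d \<ge> 6 \<Longrightarrow> img d = {}"
  by (simp add: basis_def)

text \<open>All quadratic monomials except uz, xz and yz occur. They are written as products without
  powers, the normal form that derivatives take in \<open>closure2\<close>.\<close>

lemma img3_span:
  assumes "m \<in> {u * u, u * v, v * v, u * x, u * y, v * x, v * y, v * z, x * x, x * y, y * y, z * z}"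
  shows "m \<in> mpoly.span (img 3)"
  using assms unfolding img
  by (auto intro: span_cancel_numeral simp: power2_eq_square)

lemma img4_span:
  assumes "m \<in> {x, y, z, u, v}"
  shows "m \<in> mpoly.span (img 4)"
  using assms unfolding img by (auto intro: span_cancel_numeral)

lemma img5_span: "1 \<in> mpoly.span (img 5)"
  unfolding img by (auto intro: span_cancel_numeral)

lemma closure0: "p \<in> img 0 \<Longrightarrow> pdiff i p \<in> mpoly.span (img 1)"
  unfolding img
  by (cases i) (simp_all add: F D algebra_simps mpoly.span_base)

text \<open>Each of these is a second derivative of F, hence literally a member of the next list, or
  zero in the cases UZ, XZ and YZ.\<close>

lemma closure1: "p \<in> img 1 \<Longrightarrow> pdiff i p \<in> mpoly.span (img 2)"
  unfolding img
  by (cases i; elim insertE emptyE;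
      simp add: D algebra_simps power2_eq_square power3_eq_cube mpoly.span_base mpoly.span_zero)

lemma closure2: "p \<in> img 2 \<Longrightarrow> pdiff i p \<in> mpoly.span (img 3)"
  unfolding img(3)
  by (cases i; elim insertE emptyE;
      simp add: D algebra_simps power2_eq_square power3_eq_cube mpoly.span_zero
        mpoly.span_add span_numeral img3_span)

lemma closure3: "p \<in> img 3 \<Longrightarrow> pdiff i p \<in> mpoly.span (img 4)"
  unfolding img(4)
  by (cases i; elim insertE emptyE;
      simp add: D algebra_simps power2_eq_square power3_eq_cube mpoly.span_zero
        mpoly.span_add span_numeral img4_span)

lemma closure4: "p \<in> img 4 \<Longrightarrow> pdiff i p \<in> mpoly.span (img 5)"
  unfolding img(5)
  by (cases i; elim insertE emptyE;
      simp add: D mpoly.span_zero span_numeral img5_span)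

lemma closure5: "d \<ge> 5 \<Longrightarrow> p \<in> img d \<Longrightarrow> pdiff i p = 0"
  by (cases "d = 5") (auto simp: img img_empty D)

lemma span_img: "homogeneous d a \<Longrightarrow> diff_act a F \<in> mpoly.span (img d)"
proof (rule diff_act_homogeneous_in_span)
  show "F \<in> mpoly.span (img 0)"
    unfolding img by (simp add: mpoly.span_base)
  fix d p i assume p: "p \<in> img d"
  consider "d = 0" | "d = 1" | "d = 2" | "d = 3" | "d = 4" | "d \<ge> 5" by linarith
  then show "pdiff i p \<in> mpoly.span (img (Suc d))"
    by cases
      (use p closure0[of p i] closure1[of p i] closure2[of p i] closure3[of p i] closure4[of p i]
        closure5[of d p i] in \<open>simp_all add: mpoly.span_zero eval_nat_numeral\<close>)
qed

section \<open>Homogeneity and independence of the chosen operators\<close>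

lemma homogeneous_ops:
  "homogeneous (Suc 0) U" "homogeneous (Suc 0) V" "homogeneous (Suc 0) X"
  "homogeneous (Suc 0) Y" "homogeneous (Suc 0) Z"
  "homogeneous d p \<Longrightarrow> homogeneous (Suc d) (U * p)"
  "homogeneous d p \<Longrightarrow> homogeneous (Suc d) (V * p)"
  "homogeneous d p \<Longrightarrow> homogeneous (Suc d) (X * p)"
  "homogeneous d p \<Longrightarrow> homogeneous (Suc d) (Y * p)"
  "homogeneous d p \<Longrightarrow> homogeneous (Suc d) (Z * p)"
  using homogeneous_mvar homogeneous_mult[OF homogeneous_mvar] by (simp_all add: ops)

text \<open>Operators and polynomials share one type and the same indeterminates, so the homogeneity
  rules for operators also give the degree of \<open>F\<close>.\<close>

lemma ops_eq_vars: "U = u" "V = v" "X = x" "Y = y" "Z = z"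
  by (simp_all add: vars ops)

lemma homogeneous_basis: "list_all (homogeneous d) (basis d)"
proof (cases "d < 6")
  case True
  then consider "d = 0" | "d = 1" | "d = 2" | "d = 3" | "d = 4" | "d = 5" by linarith
  then show ?thesis
    using homogeneous_mconst[of 1]
    by cases (simp_all add: basis_def homogeneous_ops homogeneous_diff homogeneous_numeral_mult
        power2_eq_square power3_eq_cube mult.assoc mconst_1,
      simp_all add: eval_nat_numeral homogeneous_ops homogeneous_diff homogeneous_numeral_mult)
qed (simp add: basis_def)

text \<open>Partners of degree 5 - d, so that every pairing is a constant. In degree 2 both X U^2
  and YUV pair with UX (12 and 2) and with VY (2 and 4). The combination 2 X U^2 - YUV removes VY,
  and X U^2 is then free to detect VY: its other pairing, with UX, lies on the permitted side of the
  triangle, because UX is listed earlier.\<close>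

definition dual :: "nat \<Rightarrow> (var5, 'k) mpoly list" where
  "dual d = (if d < 6 then
     [[Z^2 * V^3], [X^2 * U^2, Z^2 * V^2, X * U^3, Y * U * V^2, Z * V^3],
      [X^2 * U, Y^2 * U, X * Y * U, U^3, U * V^2, V^3, U^2 * V, 2 * X * U^2 - Y * U * V,
       X * U * V, Y * U^2, X * U^2, Z * V^2],
      [U^2, U * V, V^2, U * X, U * Y, V * X, V * Y, V * Z, X^2, X * Y, Y^2, Z^2],
      [X, Y, Z, U, V], [1]] ! d else [])"

lemma lin_indep_basis: "lin_indep_in_alg F (basis d)"
proof (rule lin_indep_in_alg_triangular[where bs = "dual d" and f = "\<lambda>_. 0"])
  show "length (dual d) = length (basis d)"
    by (auto simp: basis_def dual_def numeral_eq_Suc less_Suc_eq)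
  have "list_all (\<lambda>(b, a). mpoly_eval (\<lambda>_. 0) (diff_act b (diff_act a F)) \<noteq> 0)
      (zip (dual d) (basis d)) \<and>
    sorted_wrt (\<lambda>(b, a) (b', a'). mpoly_eval (\<lambda>_. 0) (diff_act b (diff_act a' F)) = 0)
      (zip (dual d) (basis d))"
  proof (cases "d < 6")
    case True
    then consider "d = 0" | "d = 1" | "d = 2" | "d = 3" | "d = 4" | "d = 5" by linarith
    then show ?thesis
    proof cases
      case 1
      then show ?thesis
        by (simp add: basis_def dual_def F D eval_vars power2_eq_square power3_eq_cube mpoly_eval_simps)
    qed (simp_all add: basis_def dual_def first_derivatives second_derivatives third_derivatives
      fourth_derivatives fifth_derivative,
      simp_all add: D eval_vars power2_eq_square power3_eq_cube mpoly_eval_simps)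
  qed (simp add: basis_def dual_def)
  then show "list_all (\<lambda>(b, a). mpoly_eval (\<lambda>_. 0) (diff_act b (diff_act a F)) \<noteq> 0)
      (zip (dual d) (basis d))"
    "sorted_wrt (\<lambda>(b, a) (b', a'). mpoly_eval (\<lambda>_. 0) (diff_act b (diff_act a' F)) = 0)
      (zip (dual d) (basis d))"
    by simp_all
qed

text \<open>From degree 6 on the list is empty, and the statement says that the graded piece is
  zero.\<close>

lemma graded_basis_basis: "graded_basis F d (basis d)"
  by (rule graded_basisI[OF homogeneous_basis lin_indep_basis span_img])

section \<open>The first and the second Hessian\<close>

lemma hessian1:
  "hessian [U, V, X, Y, Z] F =
     48 * u^3 * v^3 *
       (u^5 * x^4 + 8 * u^4 * v * x^3 * y + 16 * u^3 * v^2 * x^2 * y^2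
        + 19 * u^2 * v^3 * x^2 * z^2 + 9 * u^2 * v^3 * x * y^3
        + 13 * u * v^4 * x * y * z^2 + 2 * u * v^4 * y^4 + 4 * v^5 * y^2 * z^2)"
proof -
  let ?M =
    "[[6 * x^2 * u + 2 * x * y * v, 2 * x * y * u + 2 * y^2 * v, 6 * x * u^2 + 2 * y * u * v,
       2 * x * u * v + 2 * y * v^2, 0],
      [2 * x * y * u + 2 * y^2 * v, 2 * y^2 * u + 6 * z^2 * v, y * u^2,
       x * u^2 + 4 * y * u * v, 6 * z * v^2],
      [6 * x * u^2 + 2 * y * u * v, y * u^2, 2 * u^3, u^2 * v, 0],
      [2 * x * u * v + 2 * y * v^2, x * u^2 + 4 * y * u * v, u^2 * v, 2 * u * v^2, 0],
      [0, 6 * z * v^2, 0, 0, 2 * v^3]]"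
  have "hessian [U, V, X, Y, Z] F = det (mat 5 5 (\<lambda>(i, j). ?M ! i ! j))"
    unfolding hessian_def
  proof (rule arg_cong[where f = det], rule cong_mat)
    fix i j :: nat
    assume "i < length [U, V, X, Y, Z]" "j < length [U, V, X, Y, Z]"
    then have "i \<in> {0, 1, 2, 3, 4}" "j \<in> {0, 1, 2, 3, 4}" by auto
    then show "(case (i, j) of (i, j) \<Rightarrow> diff_act ([U, V, X, Y, Z] ! i * [U, V, X, Y, Z] ! j) F) =
        (case (i, j) of (i, j) \<Rightarrow> ?M ! i ! j)"
      by (elim insertE emptyE; simp add: diff_act_mult first_derivatives;
          simp add: D algebra_simps power2_eq_square power3_eq_cube)
  qed simp_all
  also have "\<dots> = 48 * u^3 * v^3 *
       (u^5 * x^4 + 8 * u^4 * v * x^3 * y + 16 * u^3 * v^2 * x^2 * y^2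
        + 19 * u^2 * v^3 * x^2 * z^2 + 9 * u^2 * v^3 * x * y^3
        + 13 * u * v^4 * x * y * z^2 + 2 * u * v^4 * y^4 + 4 * v^5 * y^2 * z^2)"
  proof -
    \<comment> \<open>The six 2x2 minors of the X and Y rows in the columns U, V, X, Y. Simplifying
      them first leaves a short expansion.\<close>
    have minors:
      "2 * u^3 * (2 * u * v^2) - (u^2 * v)^2 = 3 * u^4 * v^2"
      "(6 * x * u^2 + 2 * y * u * v) * (2 * u * v^2) - (2 * x * u * v + 2 * y * v^2) * (u^2 * v) =
        10 * x * u^3 * v^2 + 2 * y * u^2 * v^3"
      "(6 * x * u^2 + 2 * y * u * v) * (u^2 * v) - (2 * x * u * v + 2 * y * v^2) * (2 * u^3) =
        2 * x * u^4 * v - 2 * y * u^3 * v^2"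
      "y * u^2 * (2 * u * v^2) - (x * u^2 + 4 * y * u * v) * (u^2 * v) =
        - (x * u^4 * v) - 2 * y * u^3 * v^2"
      "y * u^2 * (u^2 * v) - (x * u^2 + 4 * y * u * v) * (2 * u^3) =
        - (2 * x * u^5) - 7 * y * u^4 * v"
      "(6 * x * u^2 + 2 * y * u * v) * (x * u^2 + 4 * y * u * v) -
          (2 * x * u * v + 2 * y * v^2) * (y * u^2) =
        6 * x^2 * u^4 + 24 * x * y * u^3 * v + 6 * y^2 * u^2 * v^2"
      by (simp_all add: algebra_simps eval_nat_numeral)
    show ?thesis
      unfolding det_symmetric5 minors by (simp add: algebra_simps eval_nat_numeral)
  qed
  finally show ?thesis .
qed

lemma hessian1_nonzero: "hessian [U, V, X, Y, Z] F \<noteq> 0"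
proof -
  \<comment> \<open>At u = v = x = 1 and y = z = 0 only the term u^5 x^4 of the long factor
    survives, which leaves 48.\<close>
  let ?f = "\<lambda>i. case i of Var_u \<Rightarrow> 1 | Var_v \<Rightarrow> 1 | Var_x \<Rightarrow> 1 | Var_y \<Rightarrow> 0 | Var_z \<Rightarrow> (0 :: 'k)"
  have "mpoly_eval ?f (hessian [U, V, X, Y, Z] F) = 48"
    by (simp add: hessian1 mpoly_eval_simps eval_vars)
  then show ?thesis by (auto simp: mpoly_eval_zero)
qed

lemma basis_1: "basis 1 = [U, V, X, Y, Z]"
  and basis_2: "basis 2 =
    [U^2, V^2, U * V, X^2, Y^2, Z^2, X * Y, U * X, U * Y, V * X, V * Y, V * Z]"
  by (simp_all add: basis_def)

lemma hessian2: "hessian (basis 2) F = 0"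
  unfolding hessian_def
\<comment> \<open>Rows 3 to 6 are X^2, Y^2, Z^2, XY, whose images involve only u and v; columns 0 to
  2 are U^2, V^2, UV. Every other column contains X, Y or Z and kills those images.\<close>
proof (rule det_mat_zero_block[where R = "{3, 4, 5, 6}" and C = "{0, 1, 2}"])
  show "{3, 4, 5, 6} \<subseteq> {..<length (basis 2)}" by (simp add: basis_2)
  fix i j :: nat
  assume "i \<in> {3, 4, 5, 6}" and j: "j < length (basis 2)" "j \<notin> {0, 1, 2}"
  then have i: "basis 2 ! i \<in> {X^2, Y^2, Z^2, X * Y}" by (auto simp: basis_2)
  have "j \<in> {3, 4, 5, 6, 7, 8, 9, 10, 11}" using j by (simp add: basis_2) presburger
  then have "basis 2 ! j \<in> {X^2, Y^2, Z^2, X * Y, U * X, U * Y, V * X, V * Y, V * Z}"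
    by (auto simp: basis_2)
  with i have "diff_act (basis 2 ! j) (diff_act (basis 2 ! i) F) = 0"
    by (auto simp: second_derivatives) (simp_all add: D power2_eq_square power3_eq_cube)
  then show "(case (i, j) of (i, j) \<Rightarrow> diff_act (basis 2 ! i * basis 2 ! j) F) = 0"
    by (simp add: diff_act_mult[symmetric] mult.commute)
qed simp_all

lemma hilbert_function:
  "has_hilbert_function F (\<lambda>d. if d < 6 then [1, 5, 12, 12, 5, 1] ! d else 0)"
proof -
  have len: "length (basis d) = (if d < 6 then [1, 5, 12, 12, 5, 1] ! d else 0)" for d
    by (auto simp: basis_def numeral_eq_Suc less_Suc_eq)
  show ?thesis
    unfolding has_hilbert_function_def len[symmetric]
    by (rule allI) (rule graded_basis_imp_dimension[OF graded_basis_basis])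
qed

section \<open>The degree of \<open>F\<close> and the failure of the weak Lefschetz property\<close>

lemma homogeneous_F: "homogeneous 5 F"
  by (simp add: F homogeneous_add homogeneous_ops[unfolded ops_eq_vars] mult.assoc
      power2_eq_square power3_eq_cube eval_nat_numeral)

lemma total_degree_F: "total_degree F = 5"
proof (rule total_degree_homogeneous[OF homogeneous_F])
  have "mpoly_eval (\<lambda>_. 1) F \<noteq> 0"
    by (simp add: F mpoly_eval_simps eval_vars)
  then show "F \<noteq> 0" by (auto simp: mpoly_eval_zero)
qed

text \<open>The cubic \<open>m\<close> does double duty: \<open>mqF \<noteq> 0\<close> shows that
  \<open>q\<close> is nonzero in A, against injectivity, and that \<open>m\<close> is no multiple of
  \<open>l\<close> in A, against surjectivity.\<close>

lemma quadratic_kernel: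
  assumes "homogeneous 1 l"
  obtains q m where "homogeneous 2 q" "diff_act (l * q) F = 0"
    "homogeneous 3 m" "diff_act (m * q) F \<noteq> 0"
proof -
  have "alg_class F l \<in> alg_graded F 1" using assms by (auto simp: alg_graded_def)
  \<comment> \<open>The coefficients come from the basis of A_1. \<open>l'\<close> agrees with
    \<open>l\<close> only modulo \<open>ann F\<close>, which suffices because operators commute:
    \<open>l\<close> acts on \<open>qF\<close> as \<open>q\<close> acts on
    \<open>lF\<close>.\<close>
  then obtain l' where "l' \<in> mpoly.span (set [U, V, X, Y, Z])" and l': "alg_class F l = alg_class F l'"
    using graded_basis_basis[of 1] alg_Span[of F "[U, V, X, Y, Z]"]
    unfolding graded_basis_def basis_1 by auto
  then have "\<exists>a b c d e. l' - mscale a U - mscale b V - mscale c X - mscale d Y - mscale e Z = 0"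
    by (simp add: mpoly.span_insert)
  then obtain a b c d e where
    "l' - mscale a U - mscale b V - mscale c X - mscale d Y - mscale e Z = 0"
    by blast
  then have "l' = mconst a * U + mconst b * V + mconst c * X + mconst d * Y + mconst e * Z"
    by (simp add: mscale_def algebra_simps)
  then have act: "diff_act l' p = mconst a * pdiff Var_u p + mconst b * pdiff Var_v p +
      mconst c * pdiff Var_x p + mconst d * pdiff Var_y p + mconst e * pdiff Var_z p" for p
    by (simp add: D)
  have swap: "diff_act (l * q) F = diff_act l' (diff_act q F)" for q
  proof -
    have "diff_act (l * q) F = diff_act q (diff_act l F)"
      by (simp add: mult.commute[of l] diff_act_mult)
    also have "diff_act l F = diff_act l' F" using l' by (simp add: alg_class_eq_iff)
    also have "diff_act q (diff_act l' F) = diff_act l' (diff_act q F)"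
      by (simp add: diff_act_mult[symmetric] mult.commute)
    finally show ?thesis .
  qed
  have nonzero: "p \<noteq> 0" if "mpoly_eval (\<lambda>_. 0) p \<noteq> 0" for p :: "(var5, 'k) mpoly"
    using that by (auto simp: mpoly_eval_zero)
  have hom: "homogeneous 2 (X^2)" "homogeneous 3 (U^3)" "homogeneous 3 (V^3)"
    by (simp_all add: ops homogeneous_mvar_power)
  show thesis
  proof (cases "a = 0 \<and> b = 0")
    case True
    show thesis
    \<comment> \<open>X^2 F = 2u^3 is killed by X, Y and Z, and U^3 sends it to 12.\<close>
    proof (rule that[OF hom(1) _ hom(2)])
      show "diff_act (l * X^2) F = 0"
        unfolding swap second_derivatives act by (simp add: True D)
      show "diff_act (U^3 * X^2) F \<noteq> 0"
        by (rule nonzero, simp add: diff_act_mult[of "U^3"] second_derivatives)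
          (simp add: D power3_eq_cube mpoly_eval_simps)
    qed
  next
    case False
    \<comment> \<open>The coefficients are those of 2(bu - av)^3 = 2b^3 u^3 - 6ab^2 u^2 v + 6a^2 b u
      v^2 - 2a^3 v^3, read against the images 2u^3, u^2 v, 2uv^2, 2v^3 of X^2, XY, Y^2, Z^2.\<close>
    define q where "q = mconst (b^3) * X^2 - mconst (6 * b^2 * a) * (X * Y)
      + mconst (3 * b * a^2) * Y^2 - mconst (a^3) * Z^2"
    have "homogeneous 2 (X * Y)" "homogeneous 2 (Y^2)" "homogeneous 2 (Z^2)"
      by (simp_all add: power2_eq_square homogeneous_ops eval_nat_numeral)
    then have homq: "homogeneous 2 q"
      using hom(1) by (simp add: q_def homogeneous_add homogeneous_diff homogeneous_scale)
    have scale: "diff_act (mconst t * p) F = mconst t * diff_act p F" for t p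
      by (simp add: diff_act_mult diff_act_mconst)
    have "diff_act q F = mconst (b^3) * (2 * u^3) - mconst (6 * b^2 * a) * (u^2 * v)
      + mconst (3 * b * a^2) * (2 * u * v^2) - mconst (a^3) * (2 * v^3)"
      by (simp add: q_def diff_act_add_left diff_act_diff scale second_derivatives)
    then have qF: "diff_act q F = 2 * (mconst b * u - mconst a * v)^3"
      by (simp add: mconst_mult mconst_power mconst_numeral algebra_simps power2_eq_square
          power3_eq_cube)
    have lq: "diff_act (l * q) F = 0"
      unfolding swap qF act by (simp add: D algebra_simps)
    show thesis
    \<comment> \<open>U^3 sends qF to 12b^3 and V^3 sends it to -12a^3; at least one of these is
      nonzero.\<close>
    proof (cases "b = 0")
      case True
      have "diff_act (V^3 * q) F \<noteq> 0"
        using True False by (intro nonzero, simp add: diff_act_mult[of "V^3"] qF)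
          (simp add: D power2_eq_square power3_eq_cube mpoly_eval_simps eval_vars)
      then show thesis using that[OF homq lq hom(3)] by blast
    next
      case False
      have "diff_act (U^3 * q) F \<noteq> 0"
        using False by (intro nonzero, simp add: diff_act_mult[of "U^3"] qF)
          (simp add: D power2_eq_square power3_eq_cube mpoly_eval_simps eval_vars)
      then show thesis using that[OF homq lq hom(2)] by blast
    qed
  qed
qed

lemma not_weak_lefschetz: "\<not> weak_lefschetz F"
proof
  assume "weak_lefschetz F"
  then obtain l' where l': "l' \<in> alg_graded F 1"
    and "\<forall>i<5. inj_on (\<lambda>a. l' \<otimes>\<^bsub>alg F\<^esub> a) (alg_graded F i) \<or>
      (\<lambda>a. l' \<otimes>\<^bsub>alg F\<^esub> a) ` alg_graded F i = alg_graded F (i + 1)"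
    unfolding weak_lefschetz_def total_degree_F by blast
  from this(2) have "inj_on (\<lambda>a. l' \<otimes>\<^bsub>alg F\<^esub> a) (alg_graded F 2) \<or>
      (\<lambda>a. l' \<otimes>\<^bsub>alg F\<^esub> a) ` alg_graded F 2 = alg_graded F (2 + 1)"
    by (elim allE[of _ 2]) simp
  moreover obtain l where l: "homogeneous 1 l" "l' = alg_class F l"
    using l' by (auto simp: alg_graded_def)
  ultimately have
    wl: "inj_on (\<lambda>a. alg_class F l \<otimes>\<^bsub>alg F\<^esub> a) (alg_graded F 2) \<or>
      (\<lambda>a. alg_class F l \<otimes>\<^bsub>alg F\<^esub> a) ` alg_graded F 2 = alg_graded F 3"
    by simp
  obtain q m where q: "homogeneous 2 q" "diff_act (l * q) F = 0"
    and m: "homogeneous 3 m" "diff_act (m * q) F \<noteq> 0"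
    using quadratic_kernel[OF l(1)] by blast
  have "diff_act q F \<noteq> 0" using m(2) by (auto simp: diff_act_mult)
  then have "alg_class F q \<noteq> alg_class F 0" by (simp add: alg_class_eq_iff)
  moreover have "alg_class F l \<otimes>\<^bsub>alg F\<^esub> alg_class F q = alg_class F l \<otimes>\<^bsub>alg F\<^esub> alg_class F 0"
    using q(2) by (simp add: alg_class_mult alg_class_eq_iff)
  ultimately have "\<not> inj_on (\<lambda>a. alg_class F l \<otimes>\<^bsub>alg F\<^esub> a) (alg_graded F 2)"
    using q(1) homogeneous_zero[of 2] by (auto simp: inj_on_def alg_graded_def)
  moreover have "alg_class F m \<notin> (\<lambda>a. alg_class F l \<otimes>\<^bsub>alg F\<^esub> a) ` alg_graded F 2"
  proof
    assume "alg_class F m \<in> (\<lambda>a. alg_class F l \<otimes>\<^bsub>alg F\<^esub> a) ` alg_graded F 2"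
    then obtain r where "diff_act m F = diff_act (l * r) F"
      by (auto simp: alg_graded_def alg_class_mult alg_class_eq_iff)
    then have "diff_act (q * m) F = diff_act (q * (l * r)) F"
      by (simp add: diff_act_mult[of q])
    \<comment> \<open>Commuting brings the factor \<open>l * q\<close>, which kills F, to the front
      of the action: any multiple of \<open>l\<close> is annihilated by \<open>q\<close> in A, but
      \<open>m\<close> is not.\<close>
    also have "q * (l * r) = r * (l * q)" by (simp add: ac_simps)
    finally have "diff_act (m * q) F = diff_act r (diff_act (l * q) F)"
      by (simp add: diff_act_mult[of r] mult.commute[of q m])
    with q(2) m(2) show False by simp
  qed
  ultimately show False
    using wl m(1) by (auto simp: alg_graded_def)
qed

end

theorem mainTheorem4:
  fixes u v x y z U V X Y Z F :: "(var5, 'k::field_char_0) mpoly"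
  assumes "u = mvar Var_u" "v = mvar Var_v" "x = mvar Var_x" "y = mvar Var_y" "z = mvar Var_z"
    and "U = mvar Var_u" "V = mvar Var_v" "X = mvar Var_x" "Y = mvar Var_y" "Z = mvar Var_z"
    and "F = x^2 * u^3 + x * y * u^2 * v + y^2 * u * v^2 + z^2 * v^3"
  shows
    "(lin_indep_in_alg F [U, V, X, Y, Z] \<and> graded_basis F 1 [U, V, X, Y, Z] \<and>
      hessian [U, V, X, Y, Z] F =
        48 * u^3 * v^3 *
          (u^5 * x^4 + 8 * u^4 * v * x^3 * y + 16 * u^3 * v^2 * x^2 * y^2
           + 19 * u^2 * v^3 * x^2 * z^2 + 9 * u^2 * v^3 * x * y^3
           + 13 * u * v^4 * x * y * z^2 + 2 * u * v^4 * y^4 + 4 * v^5 * y^2 * z^2) \<and>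
      hessian [U, V, X, Y, Z] F \<noteq> 0) \<and>
     (graded_basis F 2
        [U^2, V^2, U * V, X^2, Y^2, Z^2, X * Y, U * X, U * Y, V * X, V * Y, V * Z] \<and>
      hessian
        [U^2, V^2, U * V, X^2, Y^2, Z^2, X * Y, U * X, U * Y, V * X, V * Y, V * Z] F = 0) \<and>
     (has_hilbert_function F (\<lambda>d. if d < 6 then [1, 5, 12, 12, 5, 1] ! d else 0) \<and>
      \<not> weak_lefschetz F) \<and>
     (\<exists>G :: (var5, 'k) mpoly. homogeneous 5 G \<and> total_degree G = 5 \<and>
        graded_basis G 1 [U, V, X, Y, Z] \<and> hessian [U, V, X, Y, Z] G \<noteq> 0 \<and>
        (\<exists>B. graded_basis G 2 B \<and> hessian B G = 0))"
proof -
  interpret quintic u v x y z U V X Y Z F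
    using assms by unfold_locales
  note basis = graded_basis_basis[of 1, unfolded basis_1] graded_basis_basis[of 2, unfolded basis_2]
  have "lin_indep_in_alg F [U, V, X, Y, Z]"
    using lin_indep_basis[of 1] by (simp only: basis_1)
  moreover have "\<exists>G :: (var5, 'k) mpoly. homogeneous 5 G \<and> total_degree G = 5 \<and>
      graded_basis G 1 [U, V, X, Y, Z] \<and> hessian [U, V, X, Y, Z] G \<noteq> 0 \<and>
      (\<exists>B. graded_basis G 2 B \<and> hessian B G = 0)"
    using homogeneous_F total_degree_F basis hessian1_nonzero hessian2[unfolded basis_2] by blast
  ultimately show ?thesis
    by (intro conjI hessian1 hessian1_nonzero hessian2[unfolded basis_2] basis hilbert_function
        not_weak_lefschetz)
qed

end
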